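(* Let $\mathbb{W}\subseteq\mathbb{V}$ be a closed linear subspace. Suppose that $f$ satisfies the structural assumption (A) stated in the context for some $\rho>0$, and define \[ \mu_f:=\begin{cases}\left(\sup\Lambda_f(\rho)\right)^{-1}&\text{if }\sup\Lambda_f(\rho)<\infty,\\ 0&\text{otherwise,}\end{cases} \qquad \kappa_f:=\max\left\{\mu_f+\frac{\rho}{2}-\frac{1}{2C_P},\,0\right\}. \] Then, for any $\Delta t>0$ with $\frac{1}{\Delta t}>\kappa_f$, the sequence $\{u^n\}_{n\ge0}\subset\mathbb{W}$ generated, from an initial guess $u^0\in\mathbb{W}$, by the iteration \[ u^{n+1}\in\mathbb{W}:\qquad B_{\Delta t}(u^{n+1},v)=\ell_{\Delta t}(u^n;v)\qquad\forall v\in\mathbb{W}, \] satisfies, for all $n\ge0$, \[ E(u^n)-E(u^{n+1})\ge\gamma_f(\Delta t)\,|||u^{n+1}-u^n|||_{\Delta t}^2, \] where \[ \gamma_f(\Delta t):=\min\left\{\frac{\frac{1}{\Delta t}-\kappa_f}{\frac{\Delta t}{C_P}+1},\ \frac{1}{2\Delta t}\right\}>0; \] in particular, the sequence $\{E(u^n)\}_n$ is monotone decreasing.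
   Context: $\Omega\subset\mathbb{R}^d$, $d\in\{1,2,3\}$, is an open bounded polytopal domain with boundary consisting of straight faces. $\mathbb{V}:=H^1_0(\Omega)$. For $\lambda>0$, $|||v|||_\lambda:=(\lambda\|\nabla v\|_{L^2(\Omega)}^2+\|v\|_{L^2(\Omega)}^2)^{1/2}$, $v\in\mathbb{V}$. $C_P>0$ is a constant depending only on $\Omega$ such that $\|v\|_{L^2(\Omega)}^2\le C_P\|\nabla v\|_{L^2(\Omega)}^2$ for all $v\in\mathbb{V}$. $f:\Omega\times\mathbb{R}\to\mathbb{R}$ is a function, with $f(\cdot,u)$ measurable for each $u\in\mathbb{R}$. For $\lambda>0$ let $\sigma_f(\lambda):=\operatorname{ess\,sup}_{\mathbf{x}\in\Omega}\sup_{u\in\mathbb{R}}\left|\frac{\partial f}{\partial u}(\mathbf{x},u)+\frac1\lambda\right|$, and for $\rho>0$ let $\Lambda_f(\rho):=\{\lambda>0:\sigma_f(\lambda)<\rho+\frac1\lambda\}$. Assumption (A) for $\rho>0$: (i) $f(\cdot,0)\in L^2(\Omega)$; (ii) $f$ is differentiable in the second variable; (iii) the set $\Lambda_f(\rho)$ is non-empty. Energy functional: $E(u)=\frac12\int_\Omega|\nabla u|^2\,d\mathbf{x}-\int_\Omega\int_0^{u(\mathbf{x})}f(\mathbf{x},s)\,ds\,d\mathbf{x}$, $u\in\mathbb{V}$. For $\lambda>0$: $B_\lambda(u,v):=\int_\Omega(\lambda\nabla u\cdot\nabla v+uv)\,d\mathbf{x}$ for $u,v\in\mathbb{V}$, and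 $\ell_\lambda(y;v):=\int_\Omega(y+\lambda f(\mathbf{x},y))v\,d\mathbf{x}$ for $y\in L^2(\Omega)$, $v\in\mathbb{V}$. *)

theory Defs
  imports "HOL-Analysis.Analysis" "HOL-Probability.Essential_Supremum"
begin

text \<open>
  A bounded connected open set whose boundary is the union of finitely many flat faces, i.e. of
  polytopes of codimension one. For \<open>DIM('a) = 1\<close> these are the bounded open intervals.
\<close>

definition polytopal_domain :: "'a::euclidean_space set \<Rightarrow> bool" where
  "polytopal_domain \<Omega> \<longleftrightarrow>
     open \<Omega> \<and> connected \<Omega> \<and> bounded \<Omega> \<and> \<Omega> \<noteq> {} \<and>
     (\<exists>F. finite F \<and> (\<forall>P\<in>F. polytope P \<and> aff_dim P = int DIM('a) - 1) \<and> frontier \<Omega> = \<Union>F)"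

section \<open>Sobolev spaces\<close>

text \<open>
  Functions on \<open>\<Omega>\<close> are represented by total functions of which only the values in \<open>\<Omega>\<close> matter.
  We work with representatives rather than with classes modulo equality almost everywhere;
  the spaces \<open>L2\<close>, \<open>H1\<close>, \<open>H10\<close> and the closed linear subspaces are closed under changes on
  null sets.
\<close>

definition L2 :: "'a::euclidean_space set \<Rightarrow> ('a \<Rightarrow> 'b::real_normed_vector) set" where
  "L2 \<Omega> = {u. u \<in> borel_measurable (lebesgue_on \<Omega>) \<and>
               integrable (lebesgue_on \<Omega>) (\<lambda>x. (norm (u x))\<^sup>2)}"

definition L2_norm :: "'a::euclidean_space set \<Rightarrow> ('a \<Rightarrow> 'b::real_normed_vector) \<Rightarrow> real" where
  "L2_norm \<Omega> u = sqrt (LINT x|lebesgue_on \<Omega>. (norm (u x))\<^sup>2)"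

abbreviation partial_deriv :: "'a::euclidean_space \<Rightarrow> ('a \<Rightarrow> real) \<Rightarrow> 'a \<Rightarrow> real" where
  "partial_deriv i \<phi> x \<equiv> frechet_derivative \<phi> (at x) i"

primrec C_k :: "nat \<Rightarrow> ('a::euclidean_space \<Rightarrow> real) \<Rightarrow> bool" where
  "C_k 0 \<phi> \<longleftrightarrow> continuous_on UNIV \<phi>"
| "C_k (Suc k) \<phi> \<longleftrightarrow> (\<forall>x. \<phi> differentiable (at x)) \<and> (\<forall>i\<in>Basis. C_k k (partial_deriv i \<phi>))"

text \<open>\<open>C\<^sub>c\<^sup>\<infinity>(\<Omega>)\<close>, with functions extended by zero to the whole space.\<close>

definition test_functions :: "'a::euclidean_space set \<Rightarrow> ('a \<Rightarrow> real) set" where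
  "test_functions \<Omega> =
     {\<phi>. (\<forall>k. C_k k \<phi>) \<and> compact (closure {x. \<phi> x \<noteq> 0}) \<and> closure {x. \<phi> x \<noteq> 0} \<subseteq> \<Omega>}"

definition has_weak_gradient ::
    "'a::euclidean_space set \<Rightarrow> ('a \<Rightarrow> real) \<Rightarrow> ('a \<Rightarrow> 'a) \<Rightarrow> bool" where
  "has_weak_gradient \<Omega> u g \<longleftrightarrow>
     (\<forall>\<phi>\<in>test_functions \<Omega>. \<forall>i\<in>Basis.
        (LINT x|lebesgue_on \<Omega>. u x * partial_deriv i \<phi> x)
          = - (LINT x|lebesgue_on \<Omega>. (g x \<bullet> i) * \<phi> x))"

definition H1 :: "'a::euclidean_space set \<Rightarrow> ('a \<Rightarrow> real) set" where
  "H1 \<Omega> = {u \<in> L2 \<Omega>. \<exists>g\<in>L2 \<Omega>. has_weak_gradient \<Omega> u g}"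

text \<open>For \<open>u \<in> H1 \<Omega>\<close> the weak gradient is determined almost everywhere in \<open>\<Omega>\<close>.\<close>

definition grad :: "'a::euclidean_space set \<Rightarrow> ('a \<Rightarrow> real) \<Rightarrow> 'a \<Rightarrow> 'a" where
  "grad \<Omega> u = (SOME g. g \<in> L2 \<Omega> \<and> has_weak_gradient \<Omega> u g)"

definition triple_norm :: "'a::euclidean_space set \<Rightarrow> real \<Rightarrow> ('a \<Rightarrow> real) \<Rightarrow> real" where
  "triple_norm \<Omega> l v = sqrt (l * (L2_norm \<Omega> (grad \<Omega> v))\<^sup>2 + (L2_norm \<Omega> v)\<^sup>2)"

abbreviation H1_norm :: "'a::euclidean_space set \<Rightarrow> ('a \<Rightarrow> real) \<Rightarrow> real" where
  "H1_norm \<Omega> \<equiv> triple_norm \<Omega> 1"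

text \<open>\<open>H\<^sup>1\<^sub>0(\<Omega>)\<close> is the closure of \<open>C\<^sub>c\<^sup>\<infinity>(\<Omega>)\<close> in \<open>H\<^sup>1(\<Omega>)\<close>.\<close>

definition H10 :: "'a::euclidean_space set \<Rightarrow> ('a \<Rightarrow> real) set" where
  "H10 \<Omega> = {u \<in> H1 \<Omega>. \<exists>\<phi>::nat \<Rightarrow> 'a \<Rightarrow> real. (\<forall>n. \<phi> n \<in> test_functions \<Omega>) \<and>
                 (\<lambda>n. H1_norm \<Omega> (\<lambda>x. \<phi> n x - u x)) \<longlonglongrightarrow> 0}"

definition closed_linear_subspace ::
    "'a::euclidean_space set \<Rightarrow> ('a \<Rightarrow> real) set \<Rightarrow> bool" where
  "closed_linear_subspace \<Omega> W \<longleftrightarrow>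
     W \<subseteq> H10 \<Omega> \<and> (\<lambda>x. 0) \<in> W \<and>
     (\<forall>v\<in>W. \<forall>w\<in>W. (\<lambda>x. v x + w x) \<in> W) \<and>
     (\<forall>c. \<forall>v\<in>W. (\<lambda>x. c * v x) \<in> W) \<and>
     (\<forall>w::nat \<Rightarrow> 'a \<Rightarrow> real. \<forall>v\<in>H10 \<Omega>.
        (\<forall>n. w n \<in> W) \<and> (\<lambda>n. H1_norm \<Omega> (\<lambda>x. w n x - v x)) \<longlonglongrightarrow> 0 \<longrightarrow> v \<in> W)"

section \<open>The nonlinearity\<close>

definition sigma_f :: "'a::euclidean_space set \<Rightarrow> ('a \<Rightarrow> real \<Rightarrow> real) \<Rightarrow> real \<Rightarrow> ereal" where
  "sigma_f \<Omega> f l =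
     esssup (lebesgue_on \<Omega>) (\<lambda>x. SUP u::real. ereal \<bar>deriv (f x) u + 1 / l\<bar>)"

definition Lambda_f :: "'a::euclidean_space set \<Rightarrow> ('a \<Rightarrow> real \<Rightarrow> real) \<Rightarrow> real \<Rightarrow> real set" where
  "Lambda_f \<Omega> f \<rho> = {l. l > 0 \<and> sigma_f \<Omega> f l < ereal (\<rho> + 1 / l)}"

definition assumption_A :: "'a::euclidean_space set \<Rightarrow> ('a \<Rightarrow> real \<Rightarrow> real) \<Rightarrow> real \<Rightarrow> bool" where
  "assumption_A \<Omega> f \<rho> \<longleftrightarrow>
     (\<lambda>x. f x 0) \<in> L2 \<Omega> \<and>
     (\<forall>x\<in>\<Omega>. \<forall>u. f x differentiable (at u)) \<and>
     Lambda_f \<Omega> f \<rho> \<noteq> {}"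

definition mu_f :: "'a::euclidean_space set \<Rightarrow> ('a \<Rightarrow> real \<Rightarrow> real) \<Rightarrow> real \<Rightarrow> real" where
  "mu_f \<Omega> f \<rho> = (if bdd_above (Lambda_f \<Omega> f \<rho>) then inverse (Sup (Lambda_f \<Omega> f \<rho>)) else 0)"

definition kappa_f ::
    "'a::euclidean_space set \<Rightarrow> ('a \<Rightarrow> real \<Rightarrow> real) \<Rightarrow> real \<Rightarrow> real \<Rightarrow> real" where
  "kappa_f \<Omega> f C\<^sub>P \<rho> = max (mu_f \<Omega> f \<rho> + \<rho> / 2 - 1 / (2 * C\<^sub>P)) 0"

definition gamma_f ::
    "'a::euclidean_space set \<Rightarrow> ('a \<Rightarrow> real \<Rightarrow> real) \<Rightarrow> real \<Rightarrow> real \<Rightarrow> real \<Rightarrow> real" where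
  "gamma_f \<Omega> f C\<^sub>P \<rho> t = min ((1 / t - kappa_f \<Omega> f C\<^sub>P \<rho>) / (t / C\<^sub>P + 1)) (1 / (2 * t))"

section \<open>Energy and iteration\<close>

text \<open>The inner integral is oriented, i.e. it changes sign when \<open>u x < 0\<close>.\<close>

definition energy ::
    "'a::euclidean_space set \<Rightarrow> ('a \<Rightarrow> real \<Rightarrow> real) \<Rightarrow> ('a \<Rightarrow> real) \<Rightarrow> real" where
  "energy \<Omega> f u =
     1 / 2 * (LINT x|lebesgue_on \<Omega>. (norm (grad \<Omega> u x))\<^sup>2)
       - (LINT x|lebesgue_on \<Omega>. (LBINT s=0..ereal (u x). f x s))"

definition B_form ::
    "'a::euclidean_space set \<Rightarrow> real \<Rightarrow> ('a \<Rightarrow> real) \<Rightarrow> ('a \<Rightarrow> real) \<Rightarrow> real" where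
  "B_form \<Omega> l u v =
     (LINT x|lebesgue_on \<Omega>. l * (grad \<Omega> u x \<bullet> grad \<Omega> v x) + u x * v x)"

definition l_form ::
    "'a::euclidean_space set \<Rightarrow> ('a \<Rightarrow> real \<Rightarrow> real) \<Rightarrow> real \<Rightarrow> ('a \<Rightarrow> real) \<Rightarrow> ('a \<Rightarrow> real) \<Rightarrow> real"
  where
  "l_form \<Omega> f l y v = (LINT x|lebesgue_on \<Omega>. (y x + l * f x (y x)) * v x)"

end

theory Submission
  imports Defs
begin

text \<open>
  Let \<open>w = u\<^bsub>n+1\<^esub> - u\<^sub>n\<close>. Testing the scheme with \<open>w\<close> gives
  \<open>\<integral>f(u\<^sub>n) w - \<integral>\<nabla>u\<^bsub>n+1\<^esub> \<bullet> \<nabla>w = \<parallel>w\<parallel>\<^sup>2 / \<Delta>t\<close>, while for every \<open>\<lambda>\<close> in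
  \<open>\<Lambda>\<^sub>f(\<rho>)\<close> the bound \<open>\<bar>\<partial>\<^sub>u f\<bar> \<le> \<rho> + 2 / \<lambda>\<close> controls the Taylor remainder of the primitive of \<open>f\<close>.
  Together they bound the energy decrease from below by
  \<open>\<parallel>\<nabla>w\<parallel>\<^sup>2 / 2 + (1 / \<Delta>t - 1 / \<lambda> - \<rho> / 2) \<parallel>w\<parallel>\<^sup>2\<close>; letting \<open>\<lambda>\<close> tend to \<open>sup \<Lambda>\<^sub>f(\<rho>)\<close>
  replaces \<open>1 / \<lambda>\<close> by \<open>\<mu>\<^sub>f\<close>, and the Poincare inequality trades a part of \<open>\<parallel>\<nabla>w\<parallel>\<^sup>2\<close> for
  \<open>\<parallel>w\<parallel>\<^sup>2\<close>. Since \<open>grad\<close> selects an arbitrary weak gradient, its additivity almost everywhere needs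
  uniqueness of weak gradients, i.e. the du Bois-Reymond lemma, which is proved by approximating the
  indicators of boxes by smooth bumps.
\<close>

section \<open>Smooth bumps and uniqueness of weak gradients\<close>

text \<open>\<open>flat 0\<close> is the classical smooth function exp (-1 / t) that is flat at the
  origin. The powers of 1 / t are included because differentiation produces them: derivatives of
  members are linear combinations of members.\<close>

definition flat :: "nat \<Rightarrow> real \<Rightarrow> real" where
  "flat m t = (if t > 0 then exp (- 1 / t) / t ^ m else 0)"

text \<open>With s = 1 / t the value is s^m / exp s, and the exponential beats every power.\<close>

lemma flat_tendsto_0: "(flat m \<longlongrightarrow> 0) (at_right 0)"
proof -
  have "((\<lambda>t. inverse t ^ m / exp (inverse t)) \<longlongrightarrow> (0::real)) (at_right 0)"
    by (rule filterlim_compose[OF tendsto_power_div_exp_0 filterlim_inverse_at_top_right])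
  then show ?thesis
    by (rule Lim_transform_eventually)
       (auto simp: eventually_at_filter flat_def exp_minus field_simps)
qed

lemma flat_has_real_derivative:
  "(flat m has_real_derivative (flat (m + 2) t - real m * flat (m + 1) t)) (at t)"
proof -
  consider "t > 0" | "t = 0" | "t < 0" by linarith
  then show ?thesis
  proof cases
    case 1
    have "((\<lambda>t. exp (- 1 / t) / t ^ m) has_real_derivative
        (flat (m + 2) t - real m * flat (m + 1) t)) (at t)"
      using 1 by (auto intro!: derivative_eq_intros simp: flat_def field_simps power2_eq_square
          simp flip: power_Suc; cases m; simp add: power_add)
    then show ?thesis
      by (rule has_field_derivative_transform_within_open[where S = "{0<..}"])
        (use 1 in \<open>auto simp: flat_def\<close>)
  next
    case 2
    \<comment> \<open>For h > 0 the difference quotient at the origin is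
      \<open>flat (Suc m) h\<close>, so the limit already known for the next index applies.\<close>
    have "((\<lambda>h. flat m h / h) \<longlongrightarrow> 0) (at_right 0)"
      by (rule Lim_transform_eventually[OF flat_tendsto_0[of "Suc m"]])
         (auto simp: eventually_at_filter flat_def field_simps)
    moreover have "((\<lambda>h. flat m h / h) \<longlongrightarrow> 0) (at_left 0)"
      by (rule Lim_transform_eventually[OF tendsto_const])
         (auto simp: eventually_at_filter flat_def)
    ultimately show ?thesis
      using 2 by (simp add: has_field_derivative_iff filterlim_split_at flat_def)
  next
    case 3
    have "((\<lambda>t. 0) has_real_derivative (flat (m + 2) t - real m * flat (m + 1) t)) (at t)"
      using 3 by (auto simp: flat_def)
    then show ?thesis
      by (rule has_field_derivative_transform_within_open[where S = "{..<0}"])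
        (use 3 in \<open>auto simp: flat_def\<close>)
  qed
qed

lemma flat_0_bounds: "0 \<le> flat 0 t" "flat 0 t \<le> 1"
  by (auto simp: flat_def)

lemma flat_0_tendsto_1:
  assumes "t > 0"
  shows "(\<lambda>n. flat 0 (real n * t)) \<longlonglongrightarrow> 1"
proof -
  have "(\<lambda>n. exp (- (1 / t) * (1 / real n))) \<longlonglongrightarrow> exp (- (1 / t) * 0)"
    by (intro tendsto_intros lim_1_over_n)
  moreover have "\<forall>\<^sub>F n in sequentially. exp (- (1 / t) * (1 / real n)) = flat 0 (real n * t)"
    using eventually_gt_at_top[of 0] by eventually_elim (use assms in \<open>auto simp: flat_def field_simps\<close>)
  ultimately show ?thesis
    by (simp add: Lim_transform_eventually)
qed

text \<open>
  An algebra closed under partial derivatives consists of smooth functions; for this one the closure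
  follows by induction on its generation.
\<close>

inductive_set flat_algebra :: "('a::euclidean_space \<Rightarrow> real) set" where
  const: "(\<lambda>x. c) \<in> flat_algebra"
| flat: "(\<lambda>x. flat m (c + x \<bullet> v)) \<in> flat_algebra"
| add: "\<phi> \<in> flat_algebra \<Longrightarrow> \<psi> \<in> flat_algebra \<Longrightarrow> (\<lambda>x. \<phi> x + \<psi> x) \<in> flat_algebra"
| mult: "\<phi> \<in> flat_algebra \<Longrightarrow> \<psi> \<in> flat_algebra \<Longrightarrow> (\<lambda>x. \<phi> x * \<psi> x) \<in> flat_algebra"

lemma flat_algebra_prod:
  "finite I \<Longrightarrow> (\<And>i. i \<in> I \<Longrightarrow> \<phi> i \<in> flat_algebra) \<Longrightarrow> (\<lambda>x. \<Prod>i\<in>I. \<phi> i x) \<in> flat_algebra"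
  by (induction I rule: finite_induct) (auto intro: flat_algebra.intros)

lemma flat_algebra_has_derivative:
  assumes "\<phi> \<in> flat_algebra"
  shows "\<exists>D. (\<forall>x. (\<phi> has_derivative D x) (at x)) \<and> (\<forall>i. (\<lambda>x. D x i) \<in> flat_algebra)"
  using assms
proof induction
  case (const c)
  show ?case
    by (rule exI[of _ "\<lambda>x i. 0"]) (auto intro: flat_algebra.const)
next
  case (flat m c v)
  let ?D = "\<lambda>x i. (flat (m + 2) (c + x \<bullet> v) - real m * flat (m + 1) (c + x \<bullet> v)) * (i \<bullet> v)"
  have "((\<lambda>x. flat m (c + x \<bullet> v)) has_derivative ?D x) (at x)" for x
  proof -
    have "((\<lambda>x. c + x \<bullet> v) has_derivative (\<lambda>i. i \<bullet> v)) (at x)"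
      by (auto intro!: derivative_eq_intros)
    from has_derivative_compose[OF this,
        OF flat_has_real_derivative[of m "c + x \<bullet> v", unfolded has_field_derivative_def]]
    show ?thesis by simp
  qed
  moreover have "(\<lambda>x. ?D x i) \<in> flat_algebra" for i
  proof -
    \<comment> \<open>The difference becomes a sum with the constant factor -m, as the algebra is
      generated by sums and products only.\<close>
    have "(\<lambda>x. (flat (m + 2) (c + x \<bullet> v) + (- real m) * flat (m + 1) (c + x \<bullet> v)) * (i \<bullet> v))
        \<in> flat_algebra"
      by (intro flat_algebra.intros)
    then show ?thesis by simp
  qed
  ultimately show ?case
    by (intro exI[of _ ?D]) simp
next
  case (add \<phi> \<psi>)
  then obtain D E where
    D: "\<And>x. (\<phi> has_derivative D x) (at x)" "\<And>i. (\<lambda>x. D x i) \<in> flat_algebra" and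
    E: "\<And>x. (\<psi> has_derivative E x) (at x)" "\<And>i. (\<lambda>x. E x i) \<in> flat_algebra"
    by blast
  show ?case
    by (rule exI[of _ "\<lambda>x i. D x i + E x i"])
      (auto intro!: has_derivative_add D E flat_algebra.add)
next
  case (mult \<phi> \<psi>)
  then obtain D E where
    D: "\<And>x. (\<phi> has_derivative D x) (at x)" "\<And>i. (\<lambda>x. D x i) \<in> flat_algebra" and
    E: "\<And>x. (\<psi> has_derivative E x) (at x)" "\<And>i. (\<lambda>x. E x i) \<in> flat_algebra"
    by blast
  show ?case
    by (rule exI[of _ "\<lambda>x i. \<phi> x * E x i + D x i * \<psi> x"])
      (auto intro!: has_derivative_mult D E flat_algebra.intros mult.hyps)
qed

lemma flat_algebra_C_k:
  assumes "\<phi> \<in> flat_algebra"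
  shows "C_k k \<phi>"
  using assms
proof (induction k arbitrary: \<phi>)
  case 0
  then obtain D where "\<And>x. (\<phi> has_derivative D x) (at x)"
    using flat_algebra_has_derivative by blast
  then show ?case
    by (auto intro!: continuous_at_imp_continuous_on has_derivative_continuous)
next
  case (Suc k)
  then obtain D where
    D: "\<And>x. (\<phi> has_derivative D x) (at x)" "\<And>i. (\<lambda>x. D x i) \<in> flat_algebra"
    using flat_algebra_has_derivative by blast
  have "partial_deriv i \<phi> = (\<lambda>x. D x i)" for i
    using frechet_derivative_at[OF D(1)] by metis
  with D Suc.IH show ?case
    by (auto simp: differentiable_def)
qed

section \<open>Smooth bumps approximating the indicator of a box\<close>

definition bump :: "'a::euclidean_space \<Rightarrow> 'a \<Rightarrow> nat \<Rightarrow> 'a \<Rightarrow> real" where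
  "bump a b n x =
     (\<Prod>i\<in>Basis. flat 0 (real n * (x \<bullet> i - a \<bullet> i)) * flat 0 (real n * (b \<bullet> i - x \<bullet> i)))"

lemma bump_bounds: "0 \<le> bump a b n x" "bump a b n x \<le> 1"
  unfolding bump_def by (auto intro!: prod_nonneg prod_le_1 mult_le_one mult_nonneg_nonneg flat_0_bounds)

lemma bump_eq_0: "x \<notin> box a b \<Longrightarrow> bump a b n x = 0"
  by (force simp: bump_def mem_box flat_def not_less zero_less_mult_iff)

text \<open>Inside the open box every factor is exp (-1 / (n t)) with some t > 0, which tends to 1
  as n grows; off the open box some factor vanishes for every n.\<close>

lemma bump_tendsto_indicator: "(\<lambda>n. bump a b n x) \<longlonglongrightarrow> indicator (box a b) x"
proof (cases "x \<in> box a b")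
  case True
  then have "(\<lambda>n. bump a b n x) \<longlonglongrightarrow> (\<Prod>i\<in>(Basis :: 'a set). 1 * 1)"
    unfolding bump_def by (intro tendsto_intros flat_0_tendsto_1) (auto simp: mem_box)
  with True show ?thesis by simp
qed (simp add: bump_eq_0)

text \<open>The hypothesis is on the closed box because the closure of the set where the bump is
  nonzero has to stay in \<open>\<Omega>\<close>.\<close>

lemma bump_test_function:
  assumes "cbox a b \<subseteq> \<Omega>"
  shows "bump a b n \<in> test_functions \<Omega>"
proof -
  \<comment> \<open>The factors are brought to the affine form c + x \<bullet> v of the generators,
    with v = n i and v = - n i.\<close>
  have "(\<lambda>x. flat 0 (- real n * (a \<bullet> i) + x \<bullet> (real n *\<^sub>R i)) *
      flat 0 (real n * (b \<bullet> i) + x \<bullet> (- real n *\<^sub>R i))) \<in> flat_algebra" for i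
    by (intro flat_algebra.intros)
  then have "bump a b n \<in> flat_algebra"
    unfolding bump_def [abs_def]
    by (intro flat_algebra_prod) (simp_all add: algebra_simps)
  moreover have sub: "closure {x. bump a b n x \<noteq> 0} \<subseteq> cbox a b"
    by (intro closure_minimal closed_cbox) (use bump_eq_0 box_subset_cbox in blast)
  moreover have "compact (closure {x. bump a b n x \<noteq> 0})"
    using compact_Int_closed[OF compact_cbox closed_closure, of a b "{x. bump a b n x \<noteq> 0}"] sub
    by (simp add: Int_absorb1)
  ultimately show ?thesis
    using assms by (auto simp: test_functions_def flat_algebra_C_k)
qed

text \<open>Henstock's lemma turns vanishing integrals over subintervals into a vanishing integral of \<open>\<bar>f\<bar>\<close>.\<close>

lemma has_integral_abs_0_if_subinterval_integrals_0:
  fixes f :: "'a::euclidean_space \<Rightarrow> real"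
  assumes "f integrable_on cbox a b"
    and "\<And>c d. cbox c d \<subseteq> cbox a b \<Longrightarrow> integral (cbox c d) f = 0"
  shows "((\<lambda>x. \<bar>f x\<bar>) has_integral 0) (cbox a b)"
  unfolding has_integral
proof (intro allI impI)
  fix e :: real
  assume "e > 0"
  from Henstock_lemma[OF assms(1) this] obtain \<gamma> where "gauge \<gamma>" and
    \<gamma>: "\<And>p. \<lbrakk>p tagged_partial_division_of (cbox a b); \<gamma> fine p\<rbrakk> \<Longrightarrow>
             (\<Sum>(x,k)\<in>p. norm (measure lborel k *\<^sub>R f x - integral k f)) < e"
    by blast
  have "norm ((\<Sum>(x, k)\<in>p. measure lborel k *\<^sub>R \<bar>f x\<bar>) - 0) < e"
    if p: "p tagged_division_of (cbox a b)" "\<gamma> fine p" for p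
  proof -
    \<comment> \<open>As the integral over each tile vanishes, the total error in Henstock's lemma
      is exactly the Riemann sum of \<bar>f\<bar>.\<close>
    have "(\<Sum>(x,k)\<in>p. norm (measure lborel k *\<^sub>R f x - integral k f)) = (\<Sum>(x, k)\<in>p. measure lborel k *\<^sub>R \<bar>f x\<bar>)"
    proof (intro sum.cong refl, clarify)
      fix x k assume "(x, k) \<in> p"
      from tagged_division_ofD(3,4)[OF p(1) this] obtain c d where "k = cbox c d" "k \<subseteq> cbox a b"
        by metis
      then have "integral k f = 0"
        using assms(2) by blast
      then show "norm (measure lborel k *\<^sub>R f x - integral k f) = measure lborel k *\<^sub>R \<bar>f x\<bar>"
        by (simp only: diff_zero norm_scaleR abs_of_nonneg[OF measure_nonneg] real_norm_def real_scaleR_def abs_mult)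
    qed
    moreover have "0 \<le> (\<Sum>(x, k)\<in>p. measure lborel k *\<^sub>R \<bar>f x\<bar>)"
      by (auto intro!: sum_nonneg)
    ultimately show ?thesis
      using \<gamma>[OF tagged_division_of_def[THEN iffD1, THEN conjunct1, OF p(1)] p(2)]
      by (simp only: diff_zero real_norm_def abs_of_nonneg)
  qed
  with \<open>gauge \<gamma>\<close> show "\<exists>\<gamma>. gauge \<gamma> \<and> (\<forall>p. p tagged_division_of cbox a b \<and> \<gamma> fine p \<longrightarrow>
      norm ((\<Sum>(x, k)\<in>p. measure lborel k *\<^sub>R \<bar>f x\<bar>) - 0) < e)"
    by (intro exI[of _ \<gamma>]) simp
qed

section \<open>The du Bois-Reymond lemma\<close>

lemma borel_measurable_test_function:
  assumes "\<phi> \<in> test_functions \<Omega>"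
  shows "\<phi> \<in> borel_measurable (lebesgue_on S)"
proof -
  have "continuous_on UNIV \<phi>"
    using assms by (auto simp: test_functions_def dest: spec[of _ 0])
  then have "\<phi> \<in> borel_measurable borel"
    by (rule borel_measurable_continuous_onI)
  then show ?thesis
    by (simp add: measurable_completion measurable_restrict_space1)
qed

lemma integrable_lebesgue_on_subset:
  fixes f :: "'a::euclidean_space \<Rightarrow> 'b::euclidean_space"
  assumes "integrable (lebesgue_on T) f" "S \<in> sets lebesgue" "T \<in> sets lebesgue" "S \<subseteq> T"
  shows "integrable (lebesgue_on S) f"
proof -
  have "set_integrable lebesgue T f"
    using assms by (simp add: integrable_restrict_space set_integrable_def)
  then have "set_integrable lebesgue S f"
    by (rule set_integrable_subset[OF _ assms(2,4)])
  then show ?thesis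
    using assms by (simp add: integrable_restrict_space set_integrable_def)
qed

text \<open>Testing with bumps and passing to the limit shows that g has integral 0 over every
  closed box in \<open>\<Omega>\<close>. By Henstock's lemma g then vanishes almost everywhere on
  each such box, and countably many of them cover \<open>\<Omega>\<close>.\<close>

lemma du_Bois_Reymond:
  fixes g :: "'a::euclidean_space \<Rightarrow> real"
  assumes \<Omega>: "open \<Omega>" and g: "integrable (lebesgue_on \<Omega>) g"
    and 0: "\<And>\<phi>. \<phi> \<in> test_functions \<Omega> \<Longrightarrow> (LINT x|lebesgue_on \<Omega>. g x * \<phi> x) = 0"
  shows "AE x in lebesgue_on \<Omega>. g x = 0"
proof -
  have \<Omega>_sets: "\<Omega> \<in> sets lebesgue"
    using \<Omega> by (auto intro: sets_completionI_sets)
  have integral_0: "integral (cbox a b) g = 0" if ab: "cbox a b \<subseteq> \<Omega>" for a b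
  proof -
    have sub: "box a b \<subseteq> \<Omega>"
      using box_subset_cbox ab by blast
    have box: "box a b \<in> sets lebesgue"
      by (auto intro: sets_completionI_sets)
    have meas [measurable]: "bump a b n \<in> borel_measurable (lebesgue_on \<Omega>)" for n
      using bump_test_function[OF ab] by (rule borel_measurable_test_function)
    have [measurable]: "g \<in> borel_measurable (lebesgue_on \<Omega>)"
      using g by auto
    have [measurable]: "indicator (box a b) \<in> borel_measurable (lebesgue_on \<Omega>)"
      using box by (intro measurable_restrict_space1 borel_measurable_indicator)
    \<comment> \<open>The bumps take values in [0, 1], so \<bar>g\<bar> dominates all the
      products.\<close>
    have "(\<lambda>n. LINT x|lebesgue_on \<Omega>. g x * bump a b n x) \<longlonglongrightarrow>
        (LINT x|lebesgue_on \<Omega>. g x * indicator (box a b) x)"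
    proof (rule integral_dominated_convergence[where w = "\<lambda>x. \<bar>g x\<bar>"])
      show "integrable (lebesgue_on \<Omega>) (\<lambda>x. \<bar>g x\<bar>)"
        using g by (rule integrable_abs)
      show "AE x in lebesgue_on \<Omega>. (\<lambda>n. g x * bump a b n x) \<longlonglongrightarrow> g x * indicator (box a b) x"
        by (intro AE_I2 tendsto_intros bump_tendsto_indicator)
      show "AE x in lebesgue_on \<Omega>. norm (g x * bump a b n x) \<le> \<bar>g x\<bar>" for n
        by (intro AE_I2) (simp add: abs_mult bump_bounds mult_left_le)
    qed measurable
    moreover have "(LINT x|lebesgue_on \<Omega>. g x * bump a b n x) = 0" for n
      by (intro 0 bump_test_function ab)
    ultimately have "(LINT x|lebesgue_on \<Omega>. g x * indicator (box a b) x) = 0"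
      by (simp add: LIMSEQ_const_iff)
    moreover have "(LINT x|lebesgue_on \<Omega>. g x * indicator (box a b) x) =
        (LINT x|lebesgue_on \<Omega>. (if x \<in> box a b then g x else 0))"
      by (intro Bochner_Integration.integral_cong) (auto simp: indicator_def)
    moreover have "\<dots> = (LINT x|lebesgue_on (box a b). g x)"
      by (simp only: Lebesgue_Measure.integral_restrict_Int[OF box \<Omega>_sets] Int_absorb2[OF sub])
    moreover have "\<dots> = integral (box a b) g"
      by (rule lebesgue_integral_eq_integral[OF integrable_lebesgue_on_subset[OF g box \<Omega>_sets sub] box])
    ultimately show ?thesis
      by (simp add: integral_open_interval)
  qed
  have AE_cbox: "AE x in lebesgue. x \<in> cbox a b \<longrightarrow> g x = 0" if ab: "cbox a b \<subseteq> \<Omega>" for a b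
  proof -
    have cbox: "cbox a b \<in> sets lebesgue"
      by (auto intro: sets_completionI_sets)
    note int = integrable_lebesgue_on_subset[OF g cbox \<Omega>_sets ab]
    have "((\<lambda>x. \<bar>g x\<bar>) has_integral 0) (cbox a b)"
      by (intro has_integral_abs_0_if_subinterval_integrals_0 integrable_on_lebesgue_on int cbox)
        (use ab integral_0 in blast)
    moreover have "((\<lambda>x. \<bar>g x\<bar>) has_integral (LINT x|lebesgue_on (cbox a b). \<bar>g x\<bar>)) (cbox a b)"
      by (intro has_integral_integral_lebesgue_on integrable_abs int cbox)
    ultimately have "(LINT x|lebesgue_on (cbox a b). \<bar>g x\<bar>) = 0"
      by (rule has_integral_unique[symmetric])
    then have "AE x in lebesgue_on (cbox a b). g x = 0"
      using integral_nonneg_eq_0_iff_AE[OF integrable_abs[OF int]] by simp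
    then show ?thesis
      using cbox by (simp add: AE_restrict_space_iff)
  qed
  obtain \<D> where \<D>: "countable \<D>" "\<D> \<subseteq> Pow \<Omega>" "\<And>X. X \<in> \<D> \<Longrightarrow> \<exists>a b. X = cbox a b" "\<Union>\<D> = \<Omega>"
    using open_countable_Union_open_cbox[OF \<Omega>] by metis
  have "AE x in lebesgue. \<forall>X\<in>\<D>. x \<in> X \<longrightarrow> g x = 0"
  proof (subst AE_ball_countable[OF \<D>(1)], intro ballI)
    fix X assume "X \<in> \<D>"
    with \<D>(2,3) obtain a b where "X = cbox a b" "X \<subseteq> \<Omega>" by blast
    then show "AE x in lebesgue. x \<in> X \<longrightarrow> g x = 0"
      using AE_cbox by simp
  qed
  then have "AE x in lebesgue. x \<in> \<Omega> \<longrightarrow> g x = 0"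
    by eventually_elim (simp flip: \<D>(4))
  then show ?thesis
    using \<Omega>_sets by (simp add: AE_restrict_space_iff)
qed

section \<open>Square-integrable functions and gradients\<close>

lemma L2D:
  assumes "u \<in> L2 \<Omega>"
  shows "u \<in> borel_measurable (lebesgue_on \<Omega>)"
    and "integrable (lebesgue_on \<Omega>) (\<lambda>x. (norm (u x))\<^sup>2)"
  using assms by (auto simp: L2_def)

lemma L2_dominated:
  fixes u :: "'a::euclidean_space \<Rightarrow> 'b::euclidean_space"
  assumes "integrable (lebesgue_on \<Omega>) w" "u \<in> borel_measurable (lebesgue_on \<Omega>)"
    and "AE x in lebesgue_on \<Omega>. (norm (u x))\<^sup>2 \<le> w x"
  shows "u \<in> L2 \<Omega>"
  unfolding L2_def
proof (intro CollectI conjI)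
  show "integrable (lebesgue_on \<Omega>) (\<lambda>x. (norm (u x))\<^sup>2)"
    by (rule Bochner_Integration.integrable_bound[OF assms(1)]) (use assms(2,3) in \<open>auto intro: order_trans[OF _ abs_ge_self]\<close>)
qed (use assms in simp)

lemma norm_add_power2_le:
  fixes a b :: "'b::real_normed_vector"
  shows "(norm (a + b))\<^sup>2 \<le> 2 * ((norm a)\<^sup>2 + (norm b)\<^sup>2)"
proof -
  have "(norm (a + b))\<^sup>2 \<le> (norm a + norm b)\<^sup>2"
    by (intro power_mono norm_triangle_ineq) simp
  also have "\<dots> \<le> 2 * ((norm a)\<^sup>2 + (norm b)\<^sup>2)"
    using sum_squares_bound[of "norm a" "norm b"] by (simp add: power2_sum)
  finally show ?thesis .
qed

lemma L2_add:
  fixes u v :: "'a::euclidean_space \<Rightarrow> 'b::euclidean_space"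
  assumes "u \<in> L2 \<Omega>" "v \<in> L2 \<Omega>"
  shows "(\<lambda>x. u x + v x) \<in> L2 \<Omega>"
  using assms
  by (intro L2_dominated[where w = "\<lambda>x. 2 * ((norm (u x))\<^sup>2 + (norm (v x))\<^sup>2)"] AE_I2
      norm_add_power2_le) (auto simp: L2_def)

lemma L2_scaleR:
  fixes u :: "'a::euclidean_space \<Rightarrow> 'b::euclidean_space"
  assumes "u \<in> L2 \<Omega>"
  shows "(\<lambda>x. c *\<^sub>R u x) \<in> L2 \<Omega>"
  using assms by (auto simp: L2_def power_mult_distrib)

lemma L2_diff:
  fixes u v :: "'a::euclidean_space \<Rightarrow> 'b::euclidean_space"
  assumes "u \<in> L2 \<Omega>" "v \<in> L2 \<Omega>"
  shows "(\<lambda>x. u x - v x) \<in> L2 \<Omega>"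
  using L2_add[OF assms(1) L2_scaleR[OF assms(2), of "-1"]] by simp

lemma L2_norm_power2: "(L2_norm \<Omega> u)\<^sup>2 = (LINT x|lebesgue_on \<Omega>. (norm (u x))\<^sup>2)"
  by (simp add: L2_norm_def)

lemma integrable_inner_L2:
  fixes u v :: "'a::euclidean_space \<Rightarrow> 'b::euclidean_space"
  assumes "u \<in> L2 \<Omega>" "v \<in> L2 \<Omega>"
  shows "integrable (lebesgue_on \<Omega>) (\<lambda>x. u x \<bullet> v x)"
proof (rule Bochner_Integration.integrable_bound)
  show "integrable (lebesgue_on \<Omega>) (\<lambda>x. (norm (u x))\<^sup>2 + (norm (v x))\<^sup>2)"
    using assms by (auto simp: L2_def)
  show "(\<lambda>x. u x \<bullet> v x) \<in> borel_measurable (lebesgue_on \<Omega>)"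
    using assms by (auto simp: L2_def)
  have "\<bar>a \<bullet> b\<bar> \<le> (norm a)\<^sup>2 + (norm b)\<^sup>2" for a b :: 'b
  proof -
    have "\<bar>a \<bullet> b\<bar> \<le> norm a * norm b"
      by (rule Cauchy_Schwarz_ineq2)
    also have "\<dots> \<le> 2 * norm a * norm b"
      by simp
    also have "\<dots> \<le> (norm a)\<^sup>2 + (norm b)\<^sup>2"
      by (rule sum_squares_bound)
    finally show ?thesis .
  qed
  then show "AE x in lebesgue_on \<Omega>. norm (u x \<bullet> v x) \<le> norm ((norm (u x))\<^sup>2 + (norm (v x))\<^sup>2)"
    by simp
qed

lemma integrable_mult_L2:
  fixes u v :: "'a::euclidean_space \<Rightarrow> real"
  assumes "u \<in> L2 \<Omega>" "v \<in> L2 \<Omega>"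
  shows "integrable (lebesgue_on \<Omega>) (\<lambda>x. u x * v x)"
  using integrable_inner_L2[OF assms] by simp

lemma L2_inner_const:
  fixes g :: "'a::euclidean_space \<Rightarrow> 'b::euclidean_space"
  assumes "g \<in> L2 \<Omega>"
  shows "(\<lambda>x. g x \<bullet> i) \<in> L2 \<Omega>"
proof (rule L2_dominated)
  show "integrable (lebesgue_on \<Omega>) (\<lambda>x. (norm (g x))\<^sup>2 * (norm i)\<^sup>2)"
    using assms by (auto simp: L2_def)
  show "(\<lambda>x. g x \<bullet> i) \<in> borel_measurable (lebesgue_on \<Omega>)"
    using assms by (auto simp: L2_def)
  show "AE x in lebesgue_on \<Omega>. (norm (g x \<bullet> i))\<^sup>2 \<le> (norm (g x))\<^sup>2 * (norm i)\<^sup>2"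
    by (intro AE_I2) (metis Cauchy_Schwarz_ineq2 abs_ge_zero power_mono power_mult_distrib real_norm_def)
qed

text \<open>Continuity bounds the function on the compact closure of \<open>\<Omega>\<close>, and
  \<open>\<Omega>\<close> has finite measure.\<close>

lemma continuous_imp_L2:
  fixes \<phi> :: "'a::euclidean_space \<Rightarrow> real"
  assumes "open \<Omega>" "bounded \<Omega>" "continuous_on UNIV \<phi>"
  shows "\<phi> \<in> L2 \<Omega>"
proof -
  interpret finite_measure "lebesgue_on \<Omega>"
    using assms by (intro finite_measure_lebesgue_on lmeasurable_open)
  have "compact (\<phi> ` closure \<Omega>)"
    using assms by (intro compact_continuous_image continuous_on_subset[OF assms(3)]) auto
  then obtain B where B: "\<And>x. x \<in> \<Omega> \<Longrightarrow> \<bar>\<phi> x\<bar> \<le> B"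
    using closure_subset by (fastforce dest!: compact_imp_bounded simp: bounded_iff)
  have "\<phi> \<in> borel_measurable borel"
    using assms(3) by (rule borel_measurable_continuous_onI)
  then have "\<phi> \<in> borel_measurable (lebesgue_on \<Omega>)"
    by (simp add: measurable_completion measurable_restrict_space1)
  then show ?thesis
    by (intro L2_dominated[where w = "\<lambda>x. B\<^sup>2"])
      (auto intro!: AE_I2 simp flip: abs_le_square_iff dest!: B)
qed

lemma test_function_L2:
  assumes "open \<Omega>" "bounded \<Omega>" "\<phi> \<in> test_functions \<Omega>"
  shows "\<phi> \<in> L2 \<Omega>" and "i \<in> Basis \<Longrightarrow> (\<lambda>x. partial_deriv i \<phi> x) \<in> L2 \<Omega>"
proof -
  have C_k: "C_k k \<phi>" for k
    using assms(3) by (simp add: test_functions_def)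
  show "\<phi> \<in> L2 \<Omega>"
    using assms(1,2) C_k[of 0] by (intro continuous_imp_L2) auto
  show "(\<lambda>x. partial_deriv i \<phi> x) \<in> L2 \<Omega>" if "i \<in> Basis"
    using assms(1,2) C_k[of 1] that by (intro continuous_imp_L2) auto
qed

section \<open>Differences and uniqueness of weak gradients\<close>

lemma has_weak_gradient_diff:
  assumes \<Omega>: "open \<Omega>" "bounded \<Omega>"
    and L2: "u \<in> L2 \<Omega>" "v \<in> L2 \<Omega>" "g \<in> L2 \<Omega>" "h \<in> L2 \<Omega>"
    and "has_weak_gradient \<Omega> u g" "has_weak_gradient \<Omega> v h"
  shows "has_weak_gradient \<Omega> (\<lambda>x. u x - v x) (\<lambda>x. g x - h x)"
  unfolding has_weak_gradient_def
proof (intro ballI)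
  fix \<phi> and i :: 'a
  assume \<phi>: "\<phi> \<in> test_functions \<Omega>" and i: "i \<in> Basis"
  note [simp] = test_function_L2(1)[OF \<Omega> \<phi>] test_function_L2(2)[OF \<Omega> \<phi> i]
    L2 L2_inner_const integrable_mult_L2
  have "(LINT x|lebesgue_on \<Omega>. (u x - v x) * partial_deriv i \<phi> x) =
      (LINT x|lebesgue_on \<Omega>. u x * partial_deriv i \<phi> x) - (LINT x|lebesgue_on \<Omega>. v x * partial_deriv i \<phi> x)"
    by (simp add: left_diff_distrib)
  also have "\<dots> = - (LINT x|lebesgue_on \<Omega>. (g x \<bullet> i) * \<phi> x) + (LINT x|lebesgue_on \<Omega>. (h x \<bullet> i) * \<phi> x)"
    using assms(7,8) \<phi> i by (simp add: has_weak_gradient_def)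
  also have "\<dots> = - (LINT x|lebesgue_on \<Omega>. ((g x - h x) \<bullet> i) * \<phi> x)"
    by (simp add: left_diff_distrib inner_diff_left)
  finally show "(LINT x|lebesgue_on \<Omega>. (u x - v x) * partial_deriv i \<phi> x) =
      - (LINT x|lebesgue_on \<Omega>. ((g x - h x) \<bullet> i) * \<phi> x)" .
qed

text \<open>Each component of g - h is orthogonal to all test functions, hence zero almost
  everywhere; the finitely many exceptional null sets are then united.\<close>

lemma weak_gradient_unique:
  assumes \<Omega>: "open \<Omega>" "bounded \<Omega>" and L2: "g \<in> L2 \<Omega>" "h \<in> L2 \<Omega>"
    and "has_weak_gradient \<Omega> u g" "has_weak_gradient \<Omega> u h"
  shows "AE x in lebesgue_on \<Omega>. g x = h x"
proof -
  have "AE x in lebesgue_on \<Omega>. (g x - h x) \<bullet> i = 0" if i: "i \<in> Basis" for i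
  proof (rule du_Bois_Reymond[OF \<Omega>(1)])
    note gh = L2_inner_const[OF L2_diff[OF L2]]
    show "integrable (lebesgue_on \<Omega>) (\<lambda>x. (g x - h x) \<bullet> i)"
      \<comment> \<open>On a bounded domain the constant 1 is square-integrable, and the product
        with it turns square-integrability into integrability.\<close>
      using integrable_mult_L2[OF gh continuous_imp_L2[OF \<Omega> continuous_on_const, of 1]] by simp
    show "(LINT x|lebesgue_on \<Omega>. (g x - h x) \<bullet> i * \<phi> x) = 0" if \<phi>: "\<phi> \<in> test_functions \<Omega>" for \<phi>
    proof -
      note [simp] = test_function_L2(1)[OF \<Omega> \<phi>] L2 L2_inner_const integrable_mult_L2
      have "(LINT x|lebesgue_on \<Omega>. (g x \<bullet> i) * \<phi> x) = (LINT x|lebesgue_on \<Omega>. (h x \<bullet> i) * \<phi> x)"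
        using assms(5,6) \<phi> i by (simp add: has_weak_gradient_def)
      then show ?thesis
        by (simp add: left_diff_distrib inner_diff_left)
    qed
  qed
  then have "AE x in lebesgue_on \<Omega>. \<forall>i\<in>Basis. (g x - h x) \<bullet> i = 0"
    by (simp add: AE_ball_countable countable_finite)
  then show ?thesis
    by eventually_elim (rule euclidean_eqI, simp add: inner_diff_left)
qed

lemma H1_imp_L2: "u \<in> H1 \<Omega> \<Longrightarrow> u \<in> L2 \<Omega>"
  by (simp add: H1_def)

lemma grad_weak_gradient:
  assumes "u \<in> H1 \<Omega>"
  shows "grad \<Omega> u \<in> L2 \<Omega>" and "has_weak_gradient \<Omega> u (grad \<Omega> u)"
proof -
  have "\<exists>g. g \<in> L2 \<Omega> \<and> has_weak_gradient \<Omega> u g"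
    using assms by (auto simp: H1_def)
  from someI_ex[OF this] show "grad \<Omega> u \<in> L2 \<Omega>" "has_weak_gradient \<Omega> u (grad \<Omega> u)"
    by (auto simp: grad_def)
qed

lemma H1_diff:
  assumes \<Omega>: "open \<Omega>" "bounded \<Omega>" and uv: "u \<in> H1 \<Omega>" "v \<in> H1 \<Omega>"
  shows "(\<lambda>x. u x - v x) \<in> H1 \<Omega>"
    and "AE x in lebesgue_on \<Omega>. grad \<Omega> (\<lambda>x. u x - v x) x = grad \<Omega> u x - grad \<Omega> v x"
proof -
  note L2 = uv[THEN H1_imp_L2] uv[THEN grad_weak_gradient(1)]
  note weak = has_weak_gradient_diff[OF \<Omega> L2 uv[THEN grad_weak_gradient(2)]]
  show diff: "(\<lambda>x. u x - v x) \<in> H1 \<Omega>"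
    unfolding H1_def using L2_diff[OF L2(1,2)] L2_diff[OF L2(3,4)] weak by blast
  show "AE x in lebesgue_on \<Omega>. grad \<Omega> (\<lambda>x. u x - v x) x = grad \<Omega> u x - grad \<Omega> v x"
    by (rule weak_gradient_unique[OF \<Omega> grad_weak_gradient(1)[OF diff] L2_diff[OF L2(3,4)]
          grad_weak_gradient(2)[OF diff] weak])
qed

section \<open>Caratheodory functions\<close>

text \<open>The second argument is rounded down to a grid of width 1 / (n + 1). The rounded function
  uses only countably many sections of \<open>f\<close>, so it is jointly measurable, and continuity
  in the second argument makes it converge pointwise to \<open>f\<close>.\<close>

lemma borel_measurable_Caratheodory:
  fixes f :: "'a \<Rightarrow> real \<Rightarrow> real"
  assumes "\<And>s. (\<lambda>x. f x s) \<in> borel_measurable M"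
    and "\<And>x. x \<in> space M \<Longrightarrow> continuous_on UNIV (f x)"
  shows "case_prod f \<in> borel_measurable (M \<Otimes>\<^sub>M borel)"
proof (rule borel_measurable_LIMSEQ_real)
  define r where "r n s = real_of_int \<lfloor>real (Suc n) * s\<rfloor> / real (Suc n)" for n s
  show "(\<lambda>n. f (fst z) (r n (snd z))) \<longlonglongrightarrow> case_prod f z" if z: "z \<in> space (M \<Otimes>\<^sub>M borel)" for z
  proof -
    have "\<bar>r n s - s\<bar> \<le> 1 / real (Suc n)" for n s
    proof -
      have "r n s - s = (real_of_int \<lfloor>real (Suc n) * s\<rfloor> - real (Suc n) * s) / real (Suc n)"
        by (simp add: r_def diff_divide_distrib)
      moreover have "\<bar>real_of_int \<lfloor>real (Suc n) * s\<rfloor> - real (Suc n) * s\<bar> \<le> 1"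
        by linarith
      ultimately show ?thesis
        by (simp only: abs_divide) (auto intro!: divide_right_mono)
    qed
    then have "(\<lambda>n. r n s - s) \<longlonglongrightarrow> 0" for s
      by (intro Lim_null_comparison[OF _ LIMSEQ_Suc[OF lim_1_over_n]] always_eventually) simp
    then have "(\<lambda>n. r n (snd z)) \<longlonglongrightarrow> snd z"
      by (simp add: LIM_zero_cancel)
    moreover have "isCont (f (fst z)) (snd z)"
      using assms(2)[of "fst z"] z by (auto simp: space_pair_measure continuous_on_eq_continuous_at)
    ultimately show ?thesis
      by (auto simp: split_beta intro: isCont_tendsto_compose)
  qed
  show "(\<lambda>z. f (fst z) (r n (snd z))) \<in> borel_measurable (M \<Otimes>\<^sub>M borel)" for n
    unfolding r_def
  proof (rule measurable_compose_countable[where f = "\<lambda>i z. f (fst z) (real_of_int i / real (Suc n))"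
        and g = "\<lambda>z. \<lfloor>real (Suc n) * snd z\<rfloor>"])
    show "(\<lambda>z. f (fst z) (real_of_int i / real (Suc n))) \<in> borel_measurable (M \<Otimes>\<^sub>M borel)" for i
      using assms(1) by (rule measurable_compose[OF measurable_fst])
  qed measurable
qed

lemma borel_measurable_Caratheodory_compose:
  fixes f :: "'a \<Rightarrow> real \<Rightarrow> real"
  assumes "\<And>s. (\<lambda>x. f x s) \<in> borel_measurable M"
    and "\<And>x. x \<in> space M \<Longrightarrow> continuous_on UNIV (f x)"
    and "u \<in> borel_measurable M"
  shows "(\<lambda>x. f x (u x)) \<in> borel_measurable M"
  using measurable_compose[OF measurable_Pair[OF measurable_ident_sets[OF refl] assms(3)]
      borel_measurable_Caratheodory[OF assms(1,2)]]
  by simp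

section \<open>Primitives in the second variable and Taylor remainders\<close>

lemma interval_integral_has_real_derivative:
  fixes f :: "real \<Rightarrow> real"
  assumes "continuous_on UNIV f"
  shows "((\<lambda>y. LBINT s=0..ereal y. f s) has_real_derivative f y) (at y)"
proof -
  \<comment> \<open>The interval contains the base point 0 and has y in its interior, so the
    one-interval form of the fundamental theorem yields a two-sided derivative at y.\<close>
  let ?a = "- \<bar>y\<bar> - 1" and ?b = "\<bar>y\<bar> + 1"
  have "((\<lambda>y. LBINT s=ereal 0..ereal y. f s) has_vector_derivative f y) (at y within {?a..?b})"
    by (rule interval_integral_FTC2) (auto intro: continuous_on_subset[OF assms])
  moreover have "at y within {?a..?b} = at y"
    by (rule at_within_Icc_at) auto
  ultimately show ?thesis
    by (simp add: has_real_derivative_iff_has_vector_derivative zero_ereal_def)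
qed

text \<open>The primitive is again a Caratheodory function: measurable in x as a parameter integral
  of a jointly measurable function, and continuous in the upper limit because it is differentiable
  there.\<close>

lemma borel_measurable_primitive_compose:
  fixes f :: "'a \<Rightarrow> real \<Rightarrow> real"
  assumes "\<And>s. (\<lambda>x. f x s) \<in> borel_measurable M"
    and "\<And>x. x \<in> space M \<Longrightarrow> continuous_on UNIV (f x)"
    and "u \<in> borel_measurable M"
  shows "(\<lambda>x. LBINT s=0..ereal (u x). f x s) \<in> borel_measurable M"
proof (rule borel_measurable_Caratheodory_compose[OF _ _ assms(3)])
  have [measurable]: "case_prod f \<in> borel_measurable (M \<Otimes>\<^sub>M lborel)"
    using borel_measurable_Caratheodory[OF assms(1,2)] by simp
  have "(\<lambda>x. LBINT s=a..b. f x s) \<in> borel_measurable M" for a b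
    unfolding interval_lebesgue_integral_def set_lebesgue_integral_def
    by measurable
  then show "(\<lambda>x. LBINT s=0..ereal y. f x s) \<in> borel_measurable M" for y .
  show "continuous_on UNIV (\<lambda>y. LBINT s=0..ereal y. f x s)" if "x \<in> space M" for x
    using interval_integral_has_real_derivative[OF assms(2)[OF that]]
    by (auto intro!: continuous_at_imp_continuous_on dest: DERIV_isCont)
qed

text \<open>The bound on f' makes F(s) + L s^2 / 2 convex, and the claim is its tangent inequality
  at x. Convexity replaces the integral form of the remainder, since f' may fail to be
  continuous.\<close>

lemma Taylor_remainder_lower_bound:
  fixes F f f' :: "real \<Rightarrow> real"
  assumes "\<And>s. (F has_real_derivative f s) (at s)" "\<And>s. (f has_real_derivative f' s) (at s)"
    and "\<And>s. f' s \<ge> - L"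
  shows "F y - F x \<ge> f x * (y - x) - L / 2 * (y - x)\<^sup>2"
proof -
  have "(f x + L * x) * (y - x) \<le> (F y + L / 2 * y\<^sup>2) - (F x + L / 2 * x\<^sup>2)"
  proof (rule f''_imp_f'[where C = UNIV and f'' = "\<lambda>s. f' s + L"])
    show "((\<lambda>s. F s + L / 2 * s\<^sup>2) has_real_derivative f s + L * s) (at s)" for s
      by (auto intro!: derivative_eq_intros assms)
    show "((\<lambda>s. f s + L * s) has_real_derivative f' s + L) (at s)" for s
      by (auto intro!: derivative_eq_intros assms)
    show "f' s + L \<ge> 0" for s
      using assms(3)[of s] by simp
  qed auto
  then show ?thesis
    by (simp add: power2_eq_square algebra_simps)
qed

lemma Taylor_remainder_bound:
  fixes F f f' :: "real \<Rightarrow> real"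
  assumes "\<And>s. (F has_real_derivative f s) (at s)" "\<And>s. (f has_real_derivative f' s) (at s)"
    and "\<And>s. \<bar>f' s\<bar> \<le> L"
  shows "\<bar>F y - F x - f x * (y - x)\<bar> \<le> L / 2 * (y - x)\<^sup>2"
proof -
  have "- L \<le> f' s" "- L \<le> - f' s" for s
    using assms(3)[of s] by linarith+
  \<comment> \<open>The one-sided bound is applied to F and to -F.\<close>
  then have "F y - F x \<ge> f x * (y - x) - L / 2 * (y - x)\<^sup>2"
      "- F y - - F x \<ge> - f x * (y - x) - L / 2 * (y - x)\<^sup>2"
    by (intro Taylor_remainder_lower_bound[where f' = f']
        Taylor_remainder_lower_bound[where f = "\<lambda>s. - f s" and f' = "\<lambda>s. - f' s"]
        DERIV_minus assms; simp)+
  then show ?thesis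
    by (simp only: abs_le_iff) linarith
qed

section \<open>Energy decrease\<close>

text \<open>The triangle inequality removes the shift 1 / l at the cost of another 1 / l. One null
  set serves all s because the supremum over s stands inside the essential supremum.\<close>

lemma Lambda_f_deriv_bound:
  assumes "l \<in> Lambda_f \<Omega> f \<rho>"
  shows "AE x in lebesgue_on \<Omega>. \<forall>s. \<bar>deriv (f x) s\<bar> \<le> \<rho> + 2 / l"
proof -
  have l: "l > 0" "sigma_f \<Omega> f l < ereal (\<rho> + 1 / l)"
    using assms by (auto simp: Lambda_f_def)
  have "AE x in lebesgue_on \<Omega>. (SUP s::real. ereal \<bar>deriv (f x) s + 1 / l\<bar>) \<le> sigma_f \<Omega> f l"
    unfolding sigma_f_def by (rule esssup_AE)
  then show ?thesis
  proof eventually_elim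
    case (elim x)
    have "\<bar>deriv (f x) s\<bar> \<le> \<rho> + 2 / l" for s
    proof -
      have "ereal \<bar>deriv (f x) s + 1 / l\<bar> \<le> (SUP s::real. ereal \<bar>deriv (f x) s + 1 / l\<bar>)"
        by (rule SUP_upper) simp
      also note elim
      also note l(2)
      finally have "\<bar>deriv (f x) s + 1 / l\<bar> < \<rho> + 1 / l"
        by simp
      moreover have "1 / l > 0" "2 / l = 1 / l + 1 / l"
        using l by (auto simp: field_simps)
      ultimately show ?thesis by linarith
    qed
    then show ?case by blast
  qed
qed

text \<open>The supremum defining \<mu>_f may be infinite or not attained, so estimates that hold
  for each l in \<Lambda>_f are passed on to \<mu>_f with an arbitrarily small loss.\<close>

lemma inverse_Lambda_f_approximates_mu_f:
  assumes "Lambda_f \<Omega> f \<rho> \<noteq> {}" "e > 0"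
  shows "\<exists>l\<in>Lambda_f \<Omega> f \<rho>. 1 / l < mu_f \<Omega> f \<rho> + e"
proof (cases "bdd_above (Lambda_f \<Omega> f \<rho>)")
  case True
  let ?S = "Sup (Lambda_f \<Omega> f \<rho>)"
  obtain l0 where "l0 \<in> Lambda_f \<Omega> f \<rho>"
    using assms by blast
  then have "?S > 0"
    using cSup_upper[OF _ True] by (force simp: Lambda_f_def)
  \<comment> \<open>This threshold is the number whose reciprocal is 1 / S + e; any l above it
    serves as a witness.\<close>
  then have "inverse (inverse ?S + e) < ?S"
    using assms(2) by (metis inverse_inverse_eq inverse_less_iff_less less_add_same_cancel1 positive_imp_inverse_positive add_pos_pos)
  then obtain l where l: "l \<in> Lambda_f \<Omega> f \<rho>" "inverse (inverse ?S + e) < l"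
    using less_cSup_iff[OF assms(1) True] by blast
  moreover have "inverse (inverse ?S + e) > 0"
    using \<open>?S > 0\<close> assms(2) by (simp add: add_pos_pos)
  ultimately have "inverse l < inverse ?S + e"
    using less_imp_inverse_less by fastforce
  with l True show ?thesis
    by (auto simp: mu_f_def inverse_eq_divide)
next
  case False
  then obtain l where "l \<in> Lambda_f \<Omega> f \<rho>" "1 / e < l"
    by (auto simp: bdd_above_def not_le)
  then have "1 / l < e"
    using assms(2) by (auto simp: Lambda_f_def field_simps)
  with False \<open>l \<in> _\<close> show ?thesis
    by (auto simp: mu_f_def)
qed

section \<open>Integrability of the nonlinear terms\<close>

lemma Nemytskii_L2:
  fixes f :: "'a::euclidean_space \<Rightarrow> real \<Rightarrow> real"
  assumes f0: "(\<lambda>x. f x 0) \<in> L2 \<Omega>"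
    and meas: "\<And>s. (\<lambda>x. f x s) \<in> borel_measurable (lebesgue_on \<Omega>)"
    and diff: "\<And>x s. x \<in> \<Omega> \<Longrightarrow> f x differentiable (at s)"
    and L: "AE x in lebesgue_on \<Omega>. \<forall>s. \<bar>deriv (f x) s\<bar> \<le> L"
    and u: "u \<in> L2 \<Omega>"
  shows "(\<lambda>x. f x (u x)) \<in> L2 \<Omega>"
proof -
  have cont: "continuous_on UNIV (f x)" if "x \<in> \<Omega>" for x
    using diff[OF that] by (simp add: continuous_at_imp_continuous_on differentiable_imp_continuous_within)
  have meas_fu: "(\<lambda>x. f x (u x)) \<in> borel_measurable (lebesgue_on \<Omega>)"
    by (rule borel_measurable_Caratheodory_compose[OF meas _ L2D(1)[OF u]]) (simp add: cont)
  show ?thesis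
  proof (rule L2_dominated)
    show "integrable (lebesgue_on \<Omega>) (\<lambda>x. 2 * ((norm (f x 0))\<^sup>2 + L\<^sup>2 * (norm (u x))\<^sup>2))"
      using L2D(2)[OF f0] L2D(2)[OF u]
      by (intro integrable_mult_right Bochner_Integration.integrable_add)
    have "AE x in lebesgue_on \<Omega>. x \<in> \<Omega>"
      using AE_space[of "lebesgue_on \<Omega>"] by simp
    with L show "AE x in lebesgue_on \<Omega>. (norm (f x (u x)))\<^sup>2 \<le> 2 * ((norm (f x 0))\<^sup>2 + L\<^sup>2 * (norm (u x))\<^sup>2)"
    proof eventually_elim
      case (elim x)
      \<comment> \<open>The mean value inequality gives linear growth in u, which keeps the
        composition in \<open>L2\<close>.\<close>
      have "norm (f x (u x) - f x 0) \<le> L * norm (u x - 0)"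
      proof (rule field_differentiable_bound[where S = UNIV and f' = "deriv (f x)"])
        show "(f x has_field_derivative deriv (f x) s) (at s)" for s
          using diff[OF elim(2)] by (simp add: DERIV_deriv_iff_real_differentiable)
      qed (use elim in auto)
      then have "(norm (f x (u x) - f x 0))\<^sup>2 \<le> (L * norm (u x))\<^sup>2"
        by (intro power_mono) simp_all
      then show ?case
        using norm_add_power2_le[of "f x 0" "f x (u x) - f x 0"] by (simp add: power_mult_distrib)
    qed
  qed (rule meas_fu)
qed

text \<open>Expanding the primitive at 0 bounds it by \<bar>f(x, 0) u\<bar> + L u^2 / 2, and both
  terms are integrable.\<close>

lemma integrable_primitive_L2:
  fixes f :: "'a::euclidean_space \<Rightarrow> real \<Rightarrow> real"
  assumes f0: "(\<lambda>x. f x 0) \<in> L2 \<Omega>"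
    and meas: "\<And>s. (\<lambda>x. f x s) \<in> borel_measurable (lebesgue_on \<Omega>)"
    and diff: "\<And>x s. x \<in> \<Omega> \<Longrightarrow> f x differentiable (at s)"
    and L: "AE x in lebesgue_on \<Omega>. \<forall>s. \<bar>deriv (f x) s\<bar> \<le> L"
    and u: "u \<in> L2 \<Omega>"
  shows "integrable (lebesgue_on \<Omega>) (\<lambda>x. LBINT s=0..ereal (u x). f x s)"
proof -
  have cont: "continuous_on UNIV (f x)" if "x \<in> \<Omega>" for x
    using diff[OF that] by (simp add: continuous_at_imp_continuous_on differentiable_imp_continuous_within)
  show ?thesis
  proof (rule Bochner_Integration.integrable_bound)
    show "integrable (lebesgue_on \<Omega>) (\<lambda>x. \<bar>f x 0 * u x\<bar> + L / 2 * (norm (u x))\<^sup>2)"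
      using L2D(2)[OF u] integrable_mult_L2[OF f0 u] by auto
    show "(\<lambda>x. LBINT s=0..ereal (u x). f x s) \<in> borel_measurable (lebesgue_on \<Omega>)"
      by (rule borel_measurable_primitive_compose[OF meas _ L2D(1)[OF u]]) (simp add: cont)
    have "AE x in lebesgue_on \<Omega>. x \<in> \<Omega>"
      using AE_space[of "lebesgue_on \<Omega>"] by simp
    with L show "AE x in lebesgue_on \<Omega>. norm (LBINT s=0..ereal (u x). f x s) \<le>
        norm (\<bar>f x 0 * u x\<bar> + L / 2 * (norm (u x))\<^sup>2)"
    proof eventually_elim
      case (elim x)
      \<comment> \<open>The integral from 0 to 0 and the term u x - 0 are spelled out so that the
        goal is an instance of the remainder bound at base point 0.\<close>
      have "\<bar>(LBINT s=0..ereal (u x). f x s) - (LBINT s=0..ereal 0. f x s) - f x 0 * (u x - 0)\<bar>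
          \<le> L / 2 * (u x - 0)\<^sup>2"
      proof (rule Taylor_remainder_bound)
        show "(f x has_real_derivative deriv (f x) s) (at s)" for s
          using diff[OF elim(2)] by (simp add: DERIV_deriv_iff_real_differentiable)
      qed (use elim cont interval_integral_has_real_derivative in auto)
      then have "\<bar>LBINT s=0..ereal (u x). f x s\<bar> \<le> \<bar>f x 0 * u x\<bar> + L / 2 * (norm (u x))\<^sup>2"
        unfolding zero_ereal_def[symmetric] interval_integral_endpoints_same diff_zero real_norm_def power2_abs
        by linarith
      then show ?case
        unfolding real_norm_def by linarith
    qed
  qed
qed

text \<open>The Dirichlet part of the energy is quadratic and expands exactly; only the primitive of
  \<open>f\<close> leaves an error, at most L / 2 times the squared norm of w = v - u. Testing the
  step with w turns the first-order terms into that squared norm divided by t.\<close>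

lemma energy_decrease:
  fixes f :: "'a::euclidean_space \<Rightarrow> real \<Rightarrow> real"
  assumes \<Omega>: "open \<Omega>" "bounded \<Omega>"
    and f0: "(\<lambda>x. f x 0) \<in> L2 \<Omega>"
    and meas: "\<And>s. (\<lambda>x. f x s) \<in> borel_measurable (lebesgue_on \<Omega>)"
    and diff: "\<And>x s. x \<in> \<Omega> \<Longrightarrow> f x differentiable (at s)"
    and L: "AE x in lebesgue_on \<Omega>. \<forall>s. \<bar>deriv (f x) s\<bar> \<le> L"
    and uv: "u \<in> H1 \<Omega>" "v \<in> H1 \<Omega>"
    and t: "t > 0"
    and step: "B_form \<Omega> t v (\<lambda>x. v x - u x) = l_form \<Omega> f t u (\<lambda>x. v x - u x)"
  shows "energy \<Omega> f u - energy \<Omega> f v \<ge>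
    1 / 2 * (L2_norm \<Omega> (grad \<Omega> (\<lambda>x. v x - u x)))\<^sup>2 + (1 / t - L / 2) * (L2_norm \<Omega> (\<lambda>x. v x - u x))\<^sup>2"
proof -
  let ?M = "lebesgue_on \<Omega>"
  define w where "w = (\<lambda>x. v x - u x)"
  define F where "F = (\<lambda>(z :: 'a \<Rightarrow> real) x. LBINT s=0..ereal (z x). f x s)"
  let ?gu = "grad \<Omega> u" and ?gv = "grad \<Omega> v" and ?gw = "grad \<Omega> w"
  have w: "w \<in> H1 \<Omega>" and gw: "AE x in ?M. ?gw x = ?gv x - ?gu x"
    unfolding w_def using H1_diff[OF \<Omega> uv(2,1)] by auto
  note L2 = uv[THEN H1_imp_L2] w[THEN H1_imp_L2]
  note gL2 = uv[THEN grad_weak_gradient(1)] w[THEN grad_weak_gradient(1)]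
  note fL2 = Nemytskii_L2[OF f0 meas diff L L2(1)]
  have FL1: "integrable ?M (F u)" "integrable ?M (F v)"
    unfolding F_def using integrable_primitive_L2[OF f0 meas diff L] L2 by simp_all
  note integrable = L2[THEN L2D(2)] gL2[THEN L2D(2)] integrable_mult_L2[OF fL2 L2(3)]
    integrable_mult_L2[OF L2(1,3)] integrable_mult_L2[OF L2(2,3)] integrable_inner_L2[OF gL2(2,3)] FL1
  have "t * (LINT x|?M. ?gv x \<bullet> ?gw x) + (LINT x|?M. v x * w x) =
      (LINT x|?M. u x * w x) + t * (LINT x|?M. f x (u x) * w x)"
    using step integrable by (simp add: B_form_def l_form_def distrib_right mult.assoc flip: w_def)
  moreover have "(LINT x|?M. v x * w x) - (LINT x|?M. u x * w x) = (LINT x|?M. (norm (w x))\<^sup>2)"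
    using integrable by (subst Bochner_Integration.integral_diff[symmetric])
      (auto simp: w_def power2_eq_square algebra_simps)
  \<comment> \<open>The terms in v w and u w combine to w^2, and the equation is divided by
    t.\<close>
  ultimately have weak_eq: "(LINT x|?M. f x (u x) * w x) - (LINT x|?M. ?gv x \<bullet> ?gw x) =
      1 / t * (LINT x|?M. (norm (w x))\<^sup>2)"
    using t by (simp add: field_simps)
  \<comment> \<open>The energies are compared through their integrands; the left integral becomes
    the claimed bound once \<open>weak_eq\<close> is inserted.\<close>
  have "(LINT x|?M. 1 / 2 * (norm (?gw x))\<^sup>2 - ?gv x \<bullet> ?gw x + f x (u x) * w x - L / 2 * (norm (w x))\<^sup>2)
      \<le> (LINT x|?M. 1 / 2 * (norm (?gu x))\<^sup>2 - 1 / 2 * (norm (?gv x))\<^sup>2 + F v x - F u x)"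
  proof (rule integral_mono_AE)
    have "AE x in ?M. x \<in> \<Omega>"
      using AE_space[of ?M] by simp
    with gw L show "AE x in ?M. 1 / 2 * (norm (?gw x))\<^sup>2 - ?gv x \<bullet> ?gw x + f x (u x) * w x - L / 2 * (norm (w x))\<^sup>2
        \<le> 1 / 2 * (norm (?gu x))\<^sup>2 - 1 / 2 * (norm (?gv x))\<^sup>2 + F v x - F u x"
    proof eventually_elim
      case (elim x)
      have "\<bar>F v x - F u x - f x (u x) * (v x - u x)\<bar> \<le> L / 2 * (v x - u x)\<^sup>2"
        unfolding F_def
      proof (rule Taylor_remainder_bound)
        show "(f x has_real_derivative deriv (f x) s) (at s)" for s
          using diff[OF elim(3)] by (simp add: DERIV_deriv_iff_real_differentiable)
        have "continuous_on UNIV (f x)"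
          using diff[OF elim(3)]
          by (simp add: continuous_at_imp_continuous_on differentiable_imp_continuous_within)
        then show "((\<lambda>y. LBINT s=0..ereal y. f x s) has_real_derivative f x s) (at s)" for s
          by (rule interval_integral_has_real_derivative)
      qed (use elim in auto)
      \<comment> \<open>Since the gradient of w is almost everywhere the difference of the other
        two, this is an exact identity and the gradient part loses nothing.\<close>
      moreover have "(norm (?gw x))\<^sup>2 - 2 * (?gv x \<bullet> ?gw x) = (norm (?gu x))\<^sup>2 - (norm (?gv x))\<^sup>2"
        unfolding elim(1) by (simp add: power2_norm_eq_inner inner_diff_left inner_diff_right inner_commute)
      ultimately show ?case
        unfolding w_def real_norm_def power2_abs by linarith
    qed
  qed (use integrable in auto)
  also have "\<dots> = energy \<Omega> f u - energy \<Omega> f v"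
    using integrable by (simp add: energy_def F_def)
  finally show ?thesis
    using integrable weak_eq by (simp add: L2_norm_power2 algebra_simps flip: w_def)
qed

section \<open>The constant \<gamma>_f\<close>

lemma gamma_f_pos:
  assumes "C > 0" "t > 0" "1 / t > kappa_f \<Omega> f C \<rho>"
  shows "gamma_f \<Omega> f C \<rho> t > 0"
  using assms by (auto simp: gamma_f_def intro!: divide_pos_pos add_pos_pos)

text \<open>Here G and N stand for the squared norms of the gradient and of the function. The bound
  \<gamma> \<le> 1 / (2 t) leaves the nonnegative share (1/2 - \<gamma> t) G, which the Poincare
  inequality turns into a multiple of N; the other entry of the minimum is what the resulting
  coefficients of N require.\<close>

lemma gamma_f_coercive:
  assumes "C > 0" "t > 0" "0 \<le> N" "N \<le> C * G"
  shows "gamma_f \<Omega> f C \<rho> t * (t * G + N) \<le> 1 / 2 * G + (1 / t - (mu_f \<Omega> f \<rho> + \<rho> / 2)) * N"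
proof -
  let ?\<gamma> = "gamma_f \<Omega> f C \<rho> t" and ?\<kappa> = "kappa_f \<Omega> f C \<rho>"
  have "?\<gamma> \<le> 1 / (2 * t)" "?\<gamma> \<le> (1 / t - ?\<kappa>) / (t / C + 1)"
    by (auto simp: gamma_f_def)
  moreover have "t / C + 1 > 0"
    using assms by (simp add: add_pos_pos)
  ultimately have \<gamma>: "0 \<le> 1 / 2 - ?\<gamma> * t" "?\<gamma> * (t / C + 1) \<le> 1 / t - ?\<kappa>"
    using assms by (auto simp: pos_le_divide_eq)
  have "mu_f \<Omega> f \<rho> + \<rho> / 2 \<le> ?\<kappa> + 1 / (2 * C)"
    by (simp add: kappa_f_def)
  \<comment> \<open>Q is the Poincare lower bound for G; naming it leaves inequalities linear in a
    few products.\<close>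
  define Q where "Q = N / C"
  have "(1 / 2 - ?\<gamma> * t) * Q \<le> (1 / 2 - ?\<gamma> * t) * G"
    using assms \<gamma>(1) by (intro mult_left_mono) (auto simp: Q_def field_simps)
  moreover have "?\<gamma> * t * Q + ?\<gamma> * N \<le> (1 / t - ?\<kappa>) * N"
    using mult_right_mono[OF \<gamma>(2) assms(3)] by (simp add: Q_def algebra_simps)
  moreover have "(mu_f \<Omega> f \<rho> + \<rho> / 2) * N \<le> (?\<kappa> + 1 / (2 * C)) * N"
    using assms(3) by (intro mult_right_mono) (auto simp: kappa_f_def)
  moreover have "(?\<kappa> + 1 / (2 * C)) * N = ?\<kappa> * N + Q / 2"
    by (simp add: Q_def algebra_simps)
  ultimately show ?thesis
    by (simp add: algebra_simps)
qed

section \<open>The decrease estimate along the iteration\<close>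

theorem proposition3p4:
  fixes \<Omega> :: "'a::euclidean_space set"
    and f :: "'a \<Rightarrow> real \<Rightarrow> real"
    and W :: "('a \<Rightarrow> real) set"
    and u :: "nat \<Rightarrow> 'a \<Rightarrow> real"
    and C\<^sub>P \<rho> \<Delta>t :: real
  assumes "DIM('a) \<in> {1, 2, 3}"
    and "polytopal_domain \<Omega>"
    and "C\<^sub>P > 0"
    and "\<And>v. v \<in> H10 \<Omega> \<Longrightarrow> (L2_norm \<Omega> v)\<^sup>2 \<le> C\<^sub>P * (L2_norm \<Omega> (grad \<Omega> v))\<^sup>2"
    and "\<And>s. (\<lambda>x. f x s) \<in> borel_measurable (lebesgue_on \<Omega>)"
    and "\<rho> > 0"
    and "assumption_A \<Omega> f \<rho>"
    and "closed_linear_subspace \<Omega> W"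
    and "\<Delta>t > 0"
    and "1 / \<Delta>t > kappa_f \<Omega> f C\<^sub>P \<rho>"
    and "\<And>n. u n \<in> W"
    and "\<And>n v. v \<in> W \<Longrightarrow> B_form \<Omega> \<Delta>t (u (Suc n)) v = l_form \<Omega> f \<Delta>t (u n) v"
  shows "gamma_f \<Omega> f C\<^sub>P \<rho> \<Delta>t > 0 \<and>
    (\<forall>n. energy \<Omega> f (u n) - energy \<Omega> f (u (Suc n))
           \<ge> gamma_f \<Omega> f C\<^sub>P \<rho> \<Delta>t * (triple_norm \<Omega> \<Delta>t (\<lambda>x. u (Suc n) x - u n x))\<^sup>2) \<and>
    decseq (\<lambda>n. energy \<Omega> f (u n))"
proof -
  let ?\<gamma> = "gamma_f \<Omega> f C\<^sub>P \<rho> \<Delta>t"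
  have \<gamma>: "?\<gamma> > 0"
    using assms(3,9,10) by (rule gamma_f_pos)
  have decrease: "energy \<Omega> f (u n) - energy \<Omega> f (u (Suc n))
      \<ge> ?\<gamma> * (triple_norm \<Omega> \<Delta>t (\<lambda>x. u (Suc n) x - u n x))\<^sup>2" for n
  proof -
    define w where "w = (\<lambda>x. u (Suc n) x - u n x)"
    define G where "G = (L2_norm \<Omega> (grad \<Omega> w))\<^sup>2"
    define N where "N = (L2_norm \<Omega> w)\<^sup>2"
    have \<Omega>: "open \<Omega>" "bounded \<Omega>"
      using assms(2) by (auto simp: polytopal_domain_def)
    have W: "W \<subseteq> H10 \<Omega>" "\<And>v w. v \<in> W \<Longrightarrow> w \<in> W \<Longrightarrow> (\<lambda>x. v x + w x) \<in> W"
      "\<And>c v. v \<in> W \<Longrightarrow> (\<lambda>x. c * v x) \<in> W"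
      using assms(8) by (auto simp: closed_linear_subspace_def)
    \<comment> \<open>The increment is an admissible test function: it is \<open>u (Suc n)\<close>
      plus -1 times \<open>u n\<close>.\<close>
    have w: "w \<in> W"
      using W(2)[OF assms(11)[of "Suc n"] W(3)[OF assms(11)[of n], of "-1"]] by (simp add: w_def)
    have H1: "u k \<in> H1 \<Omega>" for k
      using assms(11)[of k] W(1) by (auto simp: H10_def)
    have A: "(\<lambda>x. f x 0) \<in> L2 \<Omega>" "\<And>x s. x \<in> \<Omega> \<Longrightarrow> f x differentiable (at s)"
      "Lambda_f \<Omega> f \<rho> \<noteq> {}"
      using assms(7) by (auto simp: assumption_A_def)
    have "1 / 2 * G + (1 / \<Delta>t - (mu_f \<Omega> f \<rho> + \<rho> / 2)) * N \<le>
        energy \<Omega> f (u n) - energy \<Omega> f (u (Suc n)) + e" if "e > 0" for e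
    proof -
      have N: "N \<ge> 0"
        by (simp add: N_def)
      \<comment> \<open>The tolerance is later multiplied by N. Dividing by N + 1 keeps that product
        below e and also covers N = 0.\<close>
      have "e / (N + 1) > 0"
        using that N by simp
      then obtain l where l: "l \<in> Lambda_f \<Omega> f \<rho>" "1 / l < mu_f \<Omega> f \<rho> + e / (N + 1)"
        using inverse_Lambda_f_approximates_mu_f[OF A(3)] by blast
      \<comment> \<open>The general estimate is used with L = \<rho> + 2 / l, so that L / 2 = 1 / l
        + \<rho> / 2.\<close>
      have "1 / 2 * G + (1 / \<Delta>t - (\<rho> + 2 / l) / 2) * N \<le> energy \<Omega> f (u n) - energy \<Omega> f (u (Suc n))"
        unfolding G_def N_def w_def
        by (rule energy_decrease[OF \<Omega> A(1) assms(5) A(2) Lambda_f_deriv_bound[OF l(1)] H1 H1 assms(9)])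
          (use assms(12)[OF w] in \<open>auto simp: w_def\<close>)
      moreover have "1 / l * N \<le> (mu_f \<Omega> f \<rho> + e / (N + 1)) * N"
        using l(2) N by (intro mult_right_mono) auto
      moreover have "e / (N + 1) * N \<le> e"
        using N that by (simp add: field_simps)
      ultimately show ?thesis
        by (simp add: algebra_simps add_divide_distrib)
    qed
    then have "1 / 2 * G + (1 / \<Delta>t - (mu_f \<Omega> f \<rho> + \<rho> / 2)) * N \<le>
        energy \<Omega> f (u n) - energy \<Omega> f (u (Suc n))"
      by (rule field_le_epsilon)
    moreover have "N \<le> C\<^sub>P * G"
      unfolding N_def G_def using assms(4) W(1) w by blast
    then have "?\<gamma> * (\<Delta>t * G + N) \<le> 1 / 2 * G + (1 / \<Delta>t - (mu_f \<Omega> f \<rho> + \<rho> / 2)) * N"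
      by (intro gamma_f_coercive assms) (simp add: N_def)
    moreover have "(triple_norm \<Omega> \<Delta>t w)\<^sup>2 = \<Delta>t * G + N"
      using assms(9) by (simp add: triple_norm_def G_def N_def)
    ultimately show ?thesis
      by (simp add: w_def)
  qed
  moreover have "energy \<Omega> f (u (Suc n)) \<le> energy \<Omega> f (u n)" for n
  proof -
    have "0 \<le> ?\<gamma> * (triple_norm \<Omega> \<Delta>t (\<lambda>x. u (Suc n) x - u n x))\<^sup>2"
      using \<gamma> by simp
    with decrease[of n] show ?thesis by linarith
  qed
  ultimately show ?thesis
    using \<gamma> by (simp add: decseq_Suc_iff)
qed

end
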